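(* Let $X$ be a convex body in the plane $\mathbb C$ (with the usual metric) and let $a\in X\cap\partial X$. Then for every normalizing sequence $\tilde r$ there is a maximal self-stable family $\tilde X_{a,\tilde r}$ such that the corresponding pretangent space $\Omega_{a,\tilde r}$ is not tangent.
   Context: A convex body is a convex set $X\subseteq\mathbb C$ with nonempty interior. Pretangent and tangent spaces. Let $(X,d)$ be a metric space with a marked point $a\in X$. A normalizing sequence is a sequence $\tilde r=\{r_n\}_{n\in\mathbb N}$ of positive reals with $r_n\to0$. $\tilde X$ is the set of all sequences of points of $X$. Sequences $\tilde x=\{x_n\},\tilde y=\{y_n\}\in\tilde X$ are mutually stable w.r.t. $\tilde r$ if the finite limit $\tilde d_{\tilde r}(\tilde x,\tilde y)=\tilde d(\tilde x,\tilde y):=\lim_{n\to\infty} d(x_n,y_n)/r_n$ exists. A family $\tilde F\subseteq\tilde X$ is self-stable (w.r.t. $\tilde r$) if every two of its elements are mutually stable; it is maximal self-stable if it is self-stable and every $\tilde z\in\tilde X$ either belongs to $\tilde F$ or is not mutually stable with some $\tilde x\in\tilde F$. Write $\tilde a=(a,a,\dots)$. $\tilde X_{a,\tilde r}$ denotes a maximal self-stable (w.r.t. $\tilde r$) family containing $\tilde a$; $\tilde d$ is a pseudometric on it. The metric identification of $(\tilde X_{a,\tilde r},\tilde d)$ (the quotient by $\tilde d(\tilde x,\tilde y)=0$ with the induced metric) is denoted $\Omega_{a,\tilde r}$ and called the pretangent space corresponding to $\tilde X_{a,\tilde r}$. An isometry is a distance-preserving surjection. For a subsequence $\tilde r'=\{r_{n_k}\}_k$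 of $\tilde r$ ($n_k$ strictly increasing) and $\tilde x\in\tilde X$ put $\tilde x'=\{x_{n_k}\}_k$. There is a maximal self-stable (w.r.t. $\tilde r'$) family $\tilde X_{a,\tilde r'}\supseteq\{\tilde x':\tilde x\in\tilde X_{a,\tilde r}\}$, and $\tilde x\mapsto\tilde x'$ induces a distance-preserving map $em':\Omega_{a,\tilde r}\to\Omega_{a,\tilde r'}$, where $\Omega_{a,\tilde r'}$ is the metric identification of $\tilde X_{a,\tilde r'}$. The pretangent space $\Omega_{a,\tilde r}$ is tangent if $em'$ is an isometry for every subsequence $\tilde r'$ (this does not depend on the choice of $\tilde X_{a,\tilde r'}$). *)

theory Defs
  imports "HOL-Analysis.Analysis"
begin

text \<open>
  The ambient metric space is the type \<open>'a\<close>; the metric space under study is a subset \<open>X\<close>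
  of it with the restricted metric.
\<close>

definition normalizing_sequence :: "(nat \<Rightarrow> real) \<Rightarrow> bool" where
  "normalizing_sequence r \<longleftrightarrow> (\<forall>n. 0 < r n) \<and> r \<longlonglongrightarrow> 0"

definition point_sequences :: "'a set \<Rightarrow> (nat \<Rightarrow> 'a) set" where
  "point_sequences X = {x. \<forall>n. x n \<in> X}"

definition mutually_stable ::
    "(nat \<Rightarrow> real) \<Rightarrow> (nat \<Rightarrow> 'a::metric_space) \<Rightarrow> (nat \<Rightarrow> 'a) \<Rightarrow> bool" where
  "mutually_stable r x y \<longleftrightarrow> convergent (\<lambda>n. dist (x n) (y n) / r n)"

text \<open>Meaningful only for mutually stable \<open>x\<close> and \<open>y\<close>.\<close>

definition seq_dist ::
    "(nat \<Rightarrow> real) \<Rightarrow> (nat \<Rightarrow> 'a::metric_space) \<Rightarrow> (nat \<Rightarrow> 'a) \<Rightarrow> real" where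
  "seq_dist r x y = lim (\<lambda>n. dist (x n) (y n) / r n)"

definition self_stable :: "(nat \<Rightarrow> real) \<Rightarrow> (nat \<Rightarrow> 'a::metric_space) set \<Rightarrow> bool" where
  "self_stable r F \<longleftrightarrow> (\<forall>x\<in>F. \<forall>y\<in>F. mutually_stable r x y)"

definition maximal_self_stable ::
    "'a::metric_space set \<Rightarrow> (nat \<Rightarrow> real) \<Rightarrow> (nat \<Rightarrow> 'a) set \<Rightarrow> bool" where
  "maximal_self_stable X r F \<longleftrightarrow>
     F \<subseteq> point_sequences X \<and> self_stable r F \<and>
     (\<forall>z\<in>point_sequences X. z \<in> F \<or> (\<exists>x\<in>F. \<not> mutually_stable r z x))"

definition zero_dist_rel ::
    "(nat \<Rightarrow> real) \<Rightarrow> (nat \<Rightarrow> 'a::metric_space) set \<Rightarrow> ((nat \<Rightarrow> 'a) \<times> (nat \<Rightarrow> 'a)) set" where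
  "zero_dist_rel r F = {(x, y). x \<in> F \<and> y \<in> F \<and> seq_dist r x y = 0}"

definition pretangent_space ::
    "(nat \<Rightarrow> real) \<Rightarrow> (nat \<Rightarrow> 'a::metric_space) set \<Rightarrow> (nat \<Rightarrow> 'a) set set" where
  "pretangent_space r F = F // zero_dist_rel r F"

text \<open>The metric induced on classes: the common value of \<open>seq_dist r\<close> on representatives.\<close>

definition pretangent_dist ::
    "(nat \<Rightarrow> real) \<Rightarrow> (nat \<Rightarrow> 'a::metric_space) set \<Rightarrow> (nat \<Rightarrow> 'a) set \<Rightarrow> real" where
  "pretangent_dist r A B = (THE t. \<forall>x\<in>A. \<forall>y\<in>B. t = seq_dist r x y)"

text \<open>
  A subsequence is given by its strictly increasing index map \<open>\<nu>\<close>, so that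
  \<open>x \<circ> \<nu>\<close> is the sequence $x'$. The map on classes sends the class of \<open>x\<close> in \<open>F\<close> to the
  class of \<open>x \<circ> \<nu>\<close> in \<open>F'\<close>; the union ranges over representatives, all of which give the
  same class (see \<open>subseq_embedding_class\<close> below).
\<close>

definition subseq_embedding ::
    "(nat \<Rightarrow> real) \<Rightarrow> (nat \<Rightarrow> nat) \<Rightarrow> (nat \<Rightarrow> 'a::metric_space) set \<Rightarrow>
     (nat \<Rightarrow> 'a) set \<Rightarrow> (nat \<Rightarrow> 'a) set" where
  "subseq_embedding r \<nu> F' A = (\<Union>x\<in>A. zero_dist_rel (r \<circ> \<nu>) F' `` {x \<circ> \<nu>})"

definition isometry_onto ::
    "'b set \<Rightarrow> ('b \<Rightarrow> 'b \<Rightarrow> real) \<Rightarrow> 'c set \<Rightarrow> ('c \<Rightarrow> 'c \<Rightarrow> real) \<Rightarrow> ('b \<Rightarrow> 'c) \<Rightarrow> bool" where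
  "isometry_onto S d T e f \<longleftrightarrow>
     f ` S = T \<and> (\<forall>p\<in>S. \<forall>q\<in>S. e (f p) (f q) = d p q)"

text \<open>
  Tangency of the pretangent space of the maximal self-stable family \<open>F\<close>. Every subsequence
  admits a family \<open>F'\<close> as below (\<open>maximal_self_stable_extension\<close>), and whether the embedding is
  an isometry does not depend on its choice (\<open>isometry_onto_independent\<close>), so quantifying
  universally over \<open>F'\<close> is neither vacuous nor a restriction.
\<close>

definition tangent ::
    "'a::metric_space set \<Rightarrow> (nat \<Rightarrow> real) \<Rightarrow> (nat \<Rightarrow> 'a) set \<Rightarrow> bool" where
  "tangent X r F \<longleftrightarrow>
     (\<forall>\<nu> F'. strict_mono \<nu> \<and> maximal_self_stable X (r \<circ> \<nu>) F' \<and> (\<lambda>x. x \<circ> \<nu>) ` F \<subseteq> F' \<longrightarrow>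
        isometry_onto (pretangent_space r F) (pretangent_dist r)
          (pretangent_space (r \<circ> \<nu>) F') (pretangent_dist (r \<circ> \<nu>))
          (subseq_embedding r \<nu> F'))"


lemma seq_dist_tendsto:
  "mutually_stable r x y \<Longrightarrow> (\<lambda>n. dist (x n) (y n) / r n) \<longlonglongrightarrow> seq_dist r x y"
  by (simp add: mutually_stable_def seq_dist_def convergent_LIMSEQ_iff)

lemma seq_dist_eqI:
  "(\<lambda>n. dist (x n) (y n) / r n) \<longlonglongrightarrow> t \<Longrightarrow> seq_dist r x y = t"
  by (simp add: seq_dist_def limI)

lemma mutually_stable_commute: "mutually_stable r x y \<longleftrightarrow> mutually_stable r y x"
  by (simp add: mutually_stable_def dist_commute)

lemma seq_dist_commute: "seq_dist r x y = seq_dist r y x"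
  by (simp add: seq_dist_def dist_commute)

lemma seq_dist_refl: "seq_dist r x x = 0"
  by (rule seq_dist_eqI) simp

lemma mutually_stable_cong:
  assumes r: "\<forall>n. 0 < r n"
    and xy: "mutually_stable r x y" "seq_dist r x y = 0"
    and yz: "mutually_stable r y z"
  shows "mutually_stable r x z" "seq_dist r x z = seq_dist r y z"
proof -
  let ?d = "\<lambda>u v n. dist (u n) (v n) / r n"
  have 1: "?d x y \<longlonglongrightarrow> 0"
    using seq_dist_tendsto[OF xy(1)] xy(2) by simp
  have "(\<lambda>n. ?d x z n - ?d y z n) \<longlonglongrightarrow> 0"
  proof (rule Lim_null_comparison[OF _ 1])
    show "\<forall>\<^sub>F n in sequentially. norm (?d x z n - ?d y z n) \<le> ?d x y n"
    proof (rule always_eventually, rule allI)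
      fix n
      have "\<bar>dist (x n) (z n) - dist (y n) (z n)\<bar> \<le> dist (x n) (y n)"
        using dist_triangle[of "x n" "z n" "y n"] dist_triangle3[of "y n" "z n" "x n"]
        by (simp add: abs_le_iff)
      then show "norm (?d x z n - ?d y z n) \<le> ?d x y n"
        using r[rule_format, of n]
        by (simp flip: diff_divide_distrib add: divide_right_mono)
    qed
  qed
  from tendsto_add[OF this seq_dist_tendsto[OF yz]]
  have "?d x z \<longlonglongrightarrow> seq_dist r y z" by simp
  then show "mutually_stable r x z" "seq_dist r x z = seq_dist r y z"
    by (auto simp: mutually_stable_def convergent_def intro: seq_dist_eqI)
qed

lemma zero_dist_rel_equiv:
  assumes r: "\<forall>n. 0 < r n" and F: "self_stable r F"
  shows "equiv F (zero_dist_rel r F)"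
proof (rule equivI)
  show "zero_dist_rel r F \<subseteq> F \<times> F" by (auto simp: zero_dist_rel_def)
  show "refl_on F (zero_dist_rel r F)"
    by (auto simp: refl_on_def zero_dist_rel_def seq_dist_refl)
  show "sym (zero_dist_rel r F)"
    by (auto simp: sym_def zero_dist_rel_def seq_dist_commute)
  show "trans (zero_dist_rel r F)"
  proof (rule transI)
    fix x y z assume "(x, y) \<in> zero_dist_rel r F" "(y, z) \<in> zero_dist_rel r F"
    then show "(x, z) \<in> zero_dist_rel r F"
      using F mutually_stable_cong(2)[OF r, of x y z]
      by (simp add: zero_dist_rel_def self_stable_def)
  qed
qed

lemma pretangent_dist_class:
  assumes r: "\<forall>n. 0 < r n" and F: "self_stable r F" and xy: "x \<in> F" "y \<in> F"
  shows "pretangent_dist r (zero_dist_rel r F `` {x}) (zero_dist_rel r F `` {y}) = seq_dist r x y"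
proof -
  have eq: "seq_dist r u v = seq_dist r x y"
    if "(x, u) \<in> zero_dist_rel r F" "(y, v) \<in> zero_dist_rel r F" for u v
  proof -
    have uv: "u \<in> F" "v \<in> F" "seq_dist r x u = 0" "seq_dist r y v = 0"
      using that by (auto simp: zero_dist_rel_def)
    have "seq_dist r x y = seq_dist r u y"
      using mutually_stable_cong(2)[OF r, of x u y] F xy uv by (simp add: self_stable_def)
    also have "\<dots> = seq_dist r u v"
      using mutually_stable_cong(2)[OF r, of y v u] F xy uv
      by (simp add: self_stable_def seq_dist_commute)
    finally show ?thesis by simp
  qed
  have "(x, x) \<in> zero_dist_rel r F" "(y, y) \<in> zero_dist_rel r F"
    using xy by (auto simp: zero_dist_rel_def seq_dist_refl)
  moreover have "\<forall>u\<in>zero_dist_rel r F `` {x}. \<forall>v\<in>zero_dist_rel r F `` {y}. seq_dist r x y = seq_dist r u v"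
    using eq by (metis Image_singleton_iff)
  ultimately show ?thesis
    unfolding pretangent_dist_def by (blast intro: the_equality)
qed

lemma subseq_limit:
  assumes "strict_mono \<nu>" "mutually_stable r x y"
  shows "mutually_stable (r \<circ> \<nu>) (x \<circ> \<nu>) (y \<circ> \<nu>)"
    and "seq_dist (r \<circ> \<nu>) (x \<circ> \<nu>) (y \<circ> \<nu>) = seq_dist r x y"
proof -
  have "(\<lambda>n. dist ((x \<circ> \<nu>) n) ((y \<circ> \<nu>) n) / (r \<circ> \<nu>) n) \<longlonglongrightarrow> seq_dist r x y"
    using LIMSEQ_subseq_LIMSEQ[OF seq_dist_tendsto[OF assms(2)] assms(1)] by (simp add: o_def)
  then show "mutually_stable (r \<circ> \<nu>) (x \<circ> \<nu>) (y \<circ> \<nu>)"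
    and "seq_dist (r \<circ> \<nu>) (x \<circ> \<nu>) (y \<circ> \<nu>) = seq_dist r x y"
    unfolding mutually_stable_def convergent_def by (auto intro: seq_dist_eqI)
qed

lemma subseq_embedding_class:
  assumes r: "\<forall>n. 0 < r n" and \<nu>: "strict_mono \<nu>"
    and F: "self_stable r F" and F': "self_stable (r \<circ> \<nu>) F'" "(\<lambda>x. x \<circ> \<nu>) ` F \<subseteq> F'"
    and x: "x \<in> F"
  shows "subseq_embedding r \<nu> F' (zero_dist_rel r F `` {x}) = zero_dist_rel (r \<circ> \<nu>) F' `` {x \<circ> \<nu>}"
proof -
  have eq': "equiv F' (zero_dist_rel (r \<circ> \<nu>) F')"
    by (rule zero_dist_rel_equiv[OF _ F'(1)]) (simp add: r)
  have "(\<lambda>x. zero_dist_rel (r \<circ> \<nu>) F' `` {x \<circ> \<nu>}) respects zero_dist_rel r F"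
  proof (rule congruentI)
    fix u v assume "(u, v) \<in> zero_dist_rel r F"
    then have "u \<in> F" "v \<in> F" "seq_dist r u v = 0" by (auto simp: zero_dist_rel_def)
    with F F'(2) subseq_limit(2)[OF \<nu>, of r u v]
    have "(u \<circ> \<nu>, v \<circ> \<nu>) \<in> zero_dist_rel (r \<circ> \<nu>) F'"
      by (auto simp: zero_dist_rel_def self_stable_def)
    then show "zero_dist_rel (r \<circ> \<nu>) F' `` {u \<circ> \<nu>} = zero_dist_rel (r \<circ> \<nu>) F' `` {v \<circ> \<nu>}"
      by (rule equiv_class_eq[OF eq'])
  qed
  from UN_equiv_class[OF zero_dist_rel_equiv[OF r F] this x]
  show ?thesis unfolding subseq_embedding_def .
qed

lemma isometry_onto_iff:
  assumes r: "\<forall>n. 0 < r n" and \<nu>: "strict_mono \<nu>"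
    and F: "self_stable r F" and F': "self_stable (r \<circ> \<nu>) F'" "(\<lambda>x. x \<circ> \<nu>) ` F \<subseteq> F'"
  shows "isometry_onto (pretangent_space r F) (pretangent_dist r)
           (pretangent_space (r \<circ> \<nu>) F') (pretangent_dist (r \<circ> \<nu>)) (subseq_embedding r \<nu> F')
         \<longleftrightarrow> (\<forall>y\<in>F'. \<exists>x\<in>F. seq_dist (r \<circ> \<nu>) (x \<circ> \<nu>) y = 0)"
proof -
  let ?R = "zero_dist_rel r F" and ?R' = "zero_dist_rel (r \<circ> \<nu>) F'"
  let ?em = "subseq_embedding r \<nu> F'"
  have r': "\<forall>n. 0 < (r \<circ> \<nu>) n" by (simp add: r)
  have eq': "equiv F' ?R'" by (rule zero_dist_rel_equiv[OF r' F'(1)])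
  note em = subseq_embedding_class[OF r \<nu> F F']
  have img: "?em ` (F // ?R) = (\<lambda>x. ?R' `` {x \<circ> \<nu>}) ` F"
  proof -
    have "F // ?R = (\<lambda>x. ?R `` {x}) ` F" by (auto simp: quotient_def)
    then have "?em ` (F // ?R) = (\<lambda>x. ?em (?R `` {x})) ` F" by (simp only: image_image)
    also have "\<dots> = (\<lambda>x. ?R' `` {x \<circ> \<nu>}) ` F" by (rule image_cong[OF refl em])
    finally show ?thesis .
  qed
  have sub: "(\<lambda>x. ?R' `` {x \<circ> \<nu>}) ` F \<subseteq> F' // ?R'"
    using F'(2) by (blast intro: quotientI)
  have pres: "pretangent_dist (r \<circ> \<nu>) (?em A) (?em B) = pretangent_dist r A B"
    if "A \<in> F // ?R" "B \<in> F // ?R" for A B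
  proof -
    from that obtain x y where xy: "x \<in> F" "y \<in> F" "A = ?R `` {x}" "B = ?R `` {y}"
      by (blast elim: quotientE)
    have "x \<circ> \<nu> \<in> F'" "y \<circ> \<nu> \<in> F'" using F'(2) xy by auto
    moreover have "mutually_stable r x y" using F xy by (simp add: self_stable_def)
    ultimately show ?thesis
      using xy by (simp add: em pretangent_dist_class[OF r F]
          pretangent_dist_class[OF r' F'(1)] subseq_limit(2)[OF \<nu>])
  qed
  have "isometry_onto (pretangent_space r F) (pretangent_dist r)
           (pretangent_space (r \<circ> \<nu>) F') (pretangent_dist (r \<circ> \<nu>)) ?em
        \<longleftrightarrow> F' // ?R' \<subseteq> (\<lambda>x. ?R' `` {x \<circ> \<nu>}) ` F"
    unfolding isometry_onto_def pretangent_space_def img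
    using pres sub by blast
  also have "\<dots> \<longleftrightarrow> (\<forall>y\<in>F'. \<exists>x\<in>F. ?R' `` {y} = ?R' `` {x \<circ> \<nu>})"
    unfolding quotient_def by blast
  also have "\<dots> \<longleftrightarrow> (\<forall>y\<in>F'. \<exists>x\<in>F. seq_dist (r \<circ> \<nu>) (x \<circ> \<nu>) y = 0)"
  proof (intro ball_cong bex_cong refl)
    fix x y assume "y \<in> F'" "x \<in> F"
    moreover from this have "x \<circ> \<nu> \<in> F'" using F'(2) by auto
    ultimately show "?R' `` {y} = ?R' `` {x \<circ> \<nu>} \<longleftrightarrow> seq_dist (r \<circ> \<nu>) (x \<circ> \<nu>) y = 0"
      using eq_equiv_class_iff[OF eq', of y "x \<circ> \<nu>"]
      by (simp add: zero_dist_rel_def seq_dist_commute)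
  qed
  finally show ?thesis .
qed

lemma isometry_onto_independent:
  assumes r: "\<forall>n. 0 < r n" and \<nu>: "strict_mono \<nu>" and F: "self_stable r F"
    and F': "maximal_self_stable X (r \<circ> \<nu>) F'" "(\<lambda>x. x \<circ> \<nu>) ` F \<subseteq> F'"
    and F'': "maximal_self_stable X (r \<circ> \<nu>) F''" "(\<lambda>x. x \<circ> \<nu>) ` F \<subseteq> F''"
    and iso: "isometry_onto (pretangent_space r F) (pretangent_dist r)
           (pretangent_space (r \<circ> \<nu>) F') (pretangent_dist (r \<circ> \<nu>)) (subseq_embedding r \<nu> F')"
  shows "isometry_onto (pretangent_space r F) (pretangent_dist r)
           (pretangent_space (r \<circ> \<nu>) F'') (pretangent_dist (r \<circ> \<nu>)) (subseq_embedding r \<nu> F'')"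
proof -
  have st: "self_stable (r \<circ> \<nu>) F'" "self_stable (r \<circ> \<nu>) F''"
    using F' F'' by (auto simp: maximal_self_stable_def)
  have r': "\<forall>n. 0 < (r \<circ> \<nu>) n" by (simp add: r)
  have near: "\<exists>x\<in>F. seq_dist (r \<circ> \<nu>) (x \<circ> \<nu>) y = 0" if "y \<in> F'" for y
    using iso isometry_onto_iff[OF r \<nu> F st(1) F'(2)] that by blast
  have "z \<in> F'" if z: "z \<in> F''" for z
  proof -
    have "mutually_stable (r \<circ> \<nu>) z y" if y: "y \<in> F'" for y
    proof -
      obtain x where x: "x \<in> F" "seq_dist (r \<circ> \<nu>) (x \<circ> \<nu>) y = 0" using near[OF y] by blast
      have "x \<circ> \<nu> \<in> F'" "x \<circ> \<nu> \<in> F''" using x F'(2) F''(2) by auto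
      then have "mutually_stable (r \<circ> \<nu>) y (x \<circ> \<nu>)" "mutually_stable (r \<circ> \<nu>) (x \<circ> \<nu>) z"
        using st y z by (auto simp: self_stable_def)
      then have "mutually_stable (r \<circ> \<nu>) y z"
        using mutually_stable_cong(1)[OF r', of y "x \<circ> \<nu>" z] x(2) seq_dist_commute
        by metis
      then show ?thesis by (simp add: mutually_stable_commute)
    qed
    then show ?thesis using F' F'' z by (auto simp: maximal_self_stable_def)
  qed
  then show ?thesis
    using near isometry_onto_iff[OF r \<nu> F st(2) F''(2)] by blast
qed

lemma maximal_self_stable_extension:
  assumes "G \<subseteq> point_sequences X" "self_stable r G"
  shows "\<exists>F. maximal_self_stable X r F \<and> G \<subseteq> F"
proof -
  let ?A = "{F. G \<subseteq> F \<and> F \<subseteq> point_sequences X \<and> self_stable r F}"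
  have "\<exists>M\<in>?A. \<forall>F\<in>?A. M \<subseteq> F \<longrightarrow> F = M"
  proof (rule subset_Zorn)
    fix C assume C: "subset.chain ?A C"
    show "\<exists>U\<in>?A. \<forall>F\<in>C. F \<subseteq> U"
    proof (cases "C = {}")
      case True
      with assms show ?thesis by blast
    next
      case False
      have "self_stable r (\<Union>C)"
        unfolding self_stable_def
      proof (intro ballI)
        fix x y assume "x \<in> \<Union>C" "y \<in> \<Union>C"
        then obtain F H where "F \<in> C" "H \<in> C" "x \<in> F" "y \<in> H" by blast
        moreover from this C have "F \<subseteq> H \<or> H \<subseteq> F" by (auto simp: subset_chain_def)
        moreover have "self_stable r F" "self_stable r H"
          using C \<open>F \<in> C\<close> \<open>H \<in> C\<close> by (auto simp: subset_chain_def)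
        ultimately show "mutually_stable r x y" by (auto simp: self_stable_def)
      qed
      moreover have "G \<subseteq> \<Union>C" "\<Union>C \<subseteq> point_sequences X"
        using False C unfolding subset_chain_def by blast+
      ultimately show ?thesis by (intro bexI[of _ "\<Union>C"]) auto
    qed
  qed
  then obtain M where M: "M \<in> ?A" and max: "\<forall>F\<in>?A. M \<subseteq> F \<longrightarrow> F = M" by (rule bexE)
  have "z \<in> M" if z: "z \<in> point_sequences X" "\<forall>x\<in>M. mutually_stable r z x" for z
  proof -
    have "self_stable r (insert z M)"
      unfolding self_stable_def
    proof (intro ballI)
      fix x y assume "x \<in> insert z M" "y \<in> insert z M"
      moreover have "mutually_stable r z z" by (simp add: mutually_stable_def convergent_const)
      moreover have "mutually_stable r x z" if "x \<in> M" for x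
        using z(2) that mutually_stable_commute by blast
      ultimately show "mutually_stable r x y"
        using M z(2) unfolding self_stable_def by blast
    qed
    then have "insert z M \<in> ?A" using M z(1) by blast
    from bspec[OF max this] have "insert z M = M" by (simp add: subset_insertI)
    then show ?thesis using insertI1[of z M] by (simp only:)
  qed
  with M have "maximal_self_stable X r M" "G \<subseteq> M"
    unfolding maximal_self_stable_def by blast+
  then show ?thesis by blast
qed

end

theory Submission
  imports Defs
begin

text \<open>
  Let \<open>D\<close> be the cone of directions in which \<open>X\<close> leaves \<open>a\<close>. Magnified at \<open>a\<close> by the factors
  \<open>1 / r n\<close>, the set \<open>X\<close> fills up \<open>D\<close>: every sequence in \<open>X\<close> has its magnified terms in \<open>D\<close>, and
  every \<open>d \<in> D\<close> is the magnification of the sequence \<open>a + r n *\<^sub>R d\<close>, which lies in \<open>X\<close> from some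
  index on. Mutual stability sees only distances, so a family of sequences with
  fixed directions stays self-stable when all of them are rotated by the same angle about \<open>a\<close> at
  every other index, as long as they remain in \<open>X\<close>.

  This freedom destroys tangency. Because \<open>a\<close> is a boundary point, \<open>D\<close> lies in a half-plane, so
  there are a small rotation \<open>T\<close> and \<open>z \<in> D\<close> such that \<open>T z\<close> is outside the closure of \<open>D\<close>
  (\<open>exists_rotation_not_preserving_cone\<close>). As \<open>T\<close> is small, the directions \<open>p \<in> D\<close> with \<open>T p \<in> D\<close>
  still form a set \<open>P\<close> with interior points. Each \<open>p \<in> P\<close> gives the sequence whose magnification is
  \<open>p\<close> at even and \<open>T p\<close> at odd indices; these sequences are mutually stable, and \<open>F\<close> is any maximal
  self-stable family containing them. Since \<open>P\<close> spans the plane, the distances to these sequences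
  locate every \<open>x \<in> F\<close> (\<open>convergent_if_distances_to_spanning_set_convergent\<close>): its magnification
  tends to some \<open>l\<close> along the even indices and to \<open>T l\<close> along the odd ones, whence
  \<open>T l \<in> closure D\<close>. Along the even indices alone, however, a sequence with magnification tending
  to \<open>z\<close> is stable with all of \<open>F\<close>. It represents a point of a pretangent space of that subsequence
  which no \<open>x \<in> F\<close> reaches, because this would force \<open>l = z\<close>.
\<close>

definition rescaled :: "(nat \<Rightarrow> real) \<Rightarrow> 'a::real_vector \<Rightarrow> (nat \<Rightarrow> 'a) \<Rightarrow> nat \<Rightarrow> 'a" where
  "rescaled r a x n = (x n - a) /\<^sub>R r n"

lemma dist_rescaled:
  fixes a :: "'a::real_normed_vector"
  assumes "0 < r n"
  shows "dist (rescaled r a x n) (rescaled r a y n) = dist (x n) (y n) / r n"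
proof -
  have "rescaled r a x n - rescaled r a y n = (x n - y n) /\<^sub>R r n"
    by (simp add: rescaled_def scaleR_diff_right)
  then show ?thesis
    using assms by (simp add: dist_norm divide_inverse)
qed

lemma seq_dist_rescaled_limits:
  fixes a :: "'a::real_normed_vector"
  assumes r: "\<forall>n. 0 < r n"
    and x: "rescaled r a x \<longlonglongrightarrow> l" and y: "rescaled r a y \<longlonglongrightarrow> m"
  shows "mutually_stable r x y" and "seq_dist r x y = dist l m"
proof -
  have "(\<lambda>n. dist (x n) (y n) / r n) \<longlonglongrightarrow> dist l m"
    using tendsto_dist[OF x y] r by (simp add: dist_rescaled)
  then show "mutually_stable r x y" "seq_dist r x y = dist l m"
    by (auto simp: mutually_stable_def convergent_def intro: seq_dist_eqI)
qed

text \<open>Trilateration: \<open>2 (v \<bullet> p) = dist v 0\<^sup>2 + dist p 0\<^sup>2 - dist v p\<^sup>2\<close>, so the distances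
  determine the limits of \<open>v n \<bullet> p\<close>, first for \<open>p \<in> P\<close>, then by linearity for every \<open>p\<close>.\<close>

lemma convergent_if_distances_to_spanning_set_convergent:
  fixes v :: "nat \<Rightarrow> 'a::euclidean_space"
  assumes span: "span P = UNIV" and zero: "0 \<in> P"
    and distances: "\<And>p. p \<in> P \<Longrightarrow> convergent (\<lambda>n. dist (v n) p)"
  shows "convergent v"
proof -
  have "convergent (\<lambda>n. v n \<bullet> p)" if p: "p \<in> P" for p
  proof -
    have eq: "v n \<bullet> p = ((dist (v n) 0)\<^sup>2 + (norm p)\<^sup>2 - (dist (v n) p)\<^sup>2) / 2" for n
      by (simp add: dist_norm power2_norm_eq_inner inner_diff inner_commute)
    obtain s t where "(\<lambda>n. dist (v n) 0) \<longlonglongrightarrow> s" "(\<lambda>n. dist (v n) p) \<longlonglongrightarrow> t"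
      using distances[OF zero] distances[OF p] unfolding convergent_def by blast
    then have "(\<lambda>n. v n \<bullet> p) \<longlonglongrightarrow> (s\<^sup>2 + (norm p)\<^sup>2 - t\<^sup>2) / 2"
      unfolding eq by (intro tendsto_intros) simp_all
    then show ?thesis unfolding convergent_def by blast
  qed
  moreover have "subspace {p. convergent (\<lambda>n. v n \<bullet> p)}"
    unfolding subspace_def
    by (auto simp: inner_add_right convergent_const intro: convergent_add convergent_mult)
  ultimately have "span P \<subseteq> {p. convergent (\<lambda>n. v n \<bullet> p)}"
    by (intro span_minimal) auto
  with span have "convergent (\<lambda>n. v n \<bullet> p)" for p by auto
  then obtain L where "\<And>p. (\<lambda>n. v n \<bullet> p) \<longlonglongrightarrow> L p"
    unfolding convergent_def by metis
  then have "(\<lambda>n. \<Sum>b\<in>Basis. (v n \<bullet> b) *\<^sub>R b) \<longlonglongrightarrow> (\<Sum>b\<in>Basis. L b *\<^sub>R b)"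
    by (intro tendsto_intros)
  then show ?thesis unfolding convergent_def by (auto simp: euclidean_representation)
qed

lemma span_UNIV_if_interior_nonempty:
  fixes S :: "'a::euclidean_space set"
  assumes "interior S \<noteq> {}"
  shows "span S = UNIV"
  using assms empty_interior_lowdim[of S] dim_subset_UNIV[of S] dim_eq_full[of S] by linarith

abbreviation direction_cone :: "'a set \<Rightarrow> 'a \<Rightarrow> 'a::real_vector set" where
  "direction_cone X a \<equiv> cone hull ((\<lambda>x. x - a) ` X)"

lemma rescaled_in_direction_cone:
  assumes "x n \<in> X" "0 < r n"
  shows "rescaled r a x n \<in> direction_cone X a"
  unfolding rescaled_def cone_hull_expl
  using assms by (auto intro!: exI[of _ "inverse (r n)"])

text \<open>A direction \<open>d = k *\<^sub>R (x - a)\<close> leads to points of the segment from \<open>a\<close> to \<open>x\<close> as soon as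
  \<open>r n * k \<le> 1\<close>.\<close>

lemma eventually_in_along_direction:
  assumes X: "convex X" "a \<in> X" and r: "normalizing_sequence r"
    and d: "d \<in> direction_cone X a"
  shows "\<forall>\<^sub>F n in sequentially. a + r n *\<^sub>R d \<in> X"
proof -
  obtain k x where k: "0 \<le> k" "x \<in> X" "d = k *\<^sub>R (x - a)"
    using d unfolding cone_hull_expl by auto
  have pos: "\<forall>n. 0 < r n" and lim: "r \<longlonglongrightarrow> 0"
    using r by (auto simp: normalizing_sequence_def)
  have "(\<lambda>n. r n * k) \<longlonglongrightarrow> 0" using tendsto_mult_right[OF lim, of k] by simp
  then have "\<forall>\<^sub>F n in sequentially. r n * k < 1" by (rule order_tendstoD) simp
  then show ?thesis
  proof eventually_elim
    case (elim n)
    have "(1 - r n * k) *\<^sub>R a + (r n * k) *\<^sub>R x \<in> X"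
      using X k(1,2) elim pos[rule_format, of n] by (intro convexD) auto
    moreover have "(1 - r n * k) *\<^sub>R a + (r n * k) *\<^sub>R x = a + r n *\<^sub>R d"
      by (simp add: k(3) scaleR_diff_left scaleR_diff_right)
    ultimately show ?case by simp
  qed
qed

text \<open>The fallback value \<open>a\<close> keeps the sequence inside \<open>X\<close> at the early indices, where \<open>r n\<close> is
  still too large. If \<open>w\<close> takes its values in a finite set of directions of the cone, then the
  magnification is \<open>w\<close> from some index on (\<open>rescaled_scaled_points\<close>).\<close>

definition scaled_points :: "'a set \<Rightarrow> 'a \<Rightarrow> (nat \<Rightarrow> real) \<Rightarrow> (nat \<Rightarrow> 'a) \<Rightarrow> nat \<Rightarrow> 'a::real_vector" where
  "scaled_points X a r w n = (if a + r n *\<^sub>R w n \<in> X then a + r n *\<^sub>R w n else a)"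

lemma scaled_points_in:
  "a \<in> X \<Longrightarrow> scaled_points X a r w \<in> point_sequences X"
  by (simp add: scaled_points_def point_sequences_def)

text \<open>The threshold in \<open>eventually_in_along_direction\<close> depends on the direction; letting \<open>w\<close> range
  over a finite set of directions makes it uniform.\<close>

lemma rescaled_scaled_points:
  assumes "convex X" "a \<in> X" and r: "normalizing_sequence r"
    and W: "finite W" "W \<subseteq> direction_cone X a" and w: "\<And>n. w n \<in> W"
  shows "\<forall>\<^sub>F n in sequentially. rescaled r a (scaled_points X a r w) n = w n"
proof -
  have "\<forall>\<^sub>F n in sequentially. \<forall>d\<in>W. a + r n *\<^sub>R d \<in> X"
    using W eventually_in_along_direction[OF assms(1-3)] by (intro eventually_ball_finite) auto
  then show ?thesis
  proof eventually_elim
    case (elim n)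
    moreover have "0 < r n" using r by (simp add: normalizing_sequence_def)
    ultimately show ?case using w[of n] by (simp add: rescaled_def scaled_points_def)
  qed
qed

text \<open>Take the rotation \<open>T\<close> by \<open>pi / N\<close>. If \<open>T\<close> mapped \<open>D\<close> into its closure, so would its power
  \<open>T ^ N = - 1\<close>; but a cone lying in a half-plane does not contain the opposite of an interior
  direction. For large \<open>N\<close> an interior direction \<open>c\<close> keeps its image \<open>T * c\<close> in the interior, which
  makes the set of directions that stay in \<open>D\<close> a neighbourhood of \<open>c\<close>.\<close>

lemma exists_rotation_not_preserving_cone:
  fixes X :: "complex set"
  assumes X: "convex X" and int: "interior X \<noteq> {}" and a: "a \<in> X" "a \<notin> interior X"
  defines "D \<equiv> direction_cone X a"
  obtains T z where "norm T = 1" "interior {p \<in> D. T * p \<in> D} \<noteq> {}"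
    "z \<in> D" "T * z \<notin> closure D"
proof -
  obtain b where b: "b \<in> interior X" using int by blast
  define c where "c = b - a"
  obtain \<eta> where \<eta>: "\<And>y. y \<in> X \<Longrightarrow> \<eta> \<bullet> a \<le> \<eta> \<bullet> y" "\<And>y. y \<in> interior X \<Longrightarrow> \<eta> \<bullet> a < \<eta> \<bullet> y"
    by (rule supporting_hyperplane_rel_boundary[OF X a(1)])
      (use a(2) in \<open>auto simp: rel_interior_nonempty_interior[OF int]\<close>)
  have "(\<lambda>x. x - a) ` interior X \<subseteq> interior D"
    unfolding D_def interior_translation_subtract[symmetric]
    by (intro interior_mono hull_subset)
  then have c: "c \<in> interior D" using b by (auto simp: c_def)
  have "D \<subseteq> {y. 0 \<le> \<eta> \<bullet> y}"
    unfolding D_def cone_hull_expl using \<eta>(1) by (auto simp: inner_diff_right)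
  then have "closure D \<subseteq> {y. 0 \<le> \<eta> \<bullet> y}"
    by (rule closure_minimal) (rule closed_halfspace_ge)
  moreover have "\<eta> \<bullet> (- c) < 0" using \<eta>(2)[OF b] by (simp add: c_def inner_diff_right)
  ultimately have minus_c: "- c \<notin> closure D" by force
  have "(\<lambda>N. cis (pi / real N) * c) \<longlonglongrightarrow> cis 0 * c"
    by (intro tendsto_intros tendsto_cis lim_const_over_n)
  then have "\<forall>\<^sub>F N in sequentially. cis (pi / real N) * c \<in> interior D"
    using c by (intro topological_tendstoD) auto
  then obtain N where N: "0 < N" "cis (pi / real N) * c \<in> interior D"
    using eventually_happens'[OF sequentially_bot eventually_conj[OF eventually_gt_at_top[of 0]]]
    by blast
  define T where "T = cis (pi / real N)"
  have T_pow: "T ^ N = - 1" using N(1) by (simp add: T_def Complex.DeMoivre)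
  have "\<exists>z\<in>D. T * z \<notin> closure D"
  proof (rule ccontr)
    assume "\<not> ?thesis"
    then have "D \<subseteq> (*) T -` closure D" by auto
    then have step: "closure D \<subseteq> (*) T -` closure D"
      by (rule closure_minimal) (intro closed_vimage closed_closure continuous_intros)
    have "T ^ k * c \<in> closure D" for k
    proof (induction k)
      case 0
      then show ?case using c interior_subset closure_subset by auto
    next
      case (Suc k)
      then show ?case using step by (auto simp: mult.assoc)
    qed
    from this[of N] show False using minus_c T_pow by simp
  qed
  moreover have "interior {p \<in> D. T * p \<in> D} \<noteq> {}"
  proof -
    have "open (interior D \<inter> (*) T -` interior D)"
      by (intro open_Int open_vimage open_interior continuous_intros)
    then have "interior D \<inter> (*) T -` interior D \<subseteq> interior {p \<in> D. T * p \<in> D}"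
      using interior_subset[of D] by (intro interior_maximal) auto
    then show ?thesis using c N(2) by (auto simp: T_def)
  qed
  moreover have "norm T = 1" by (simp add: T_def)
  ultimately show thesis using that by blast
qed

definition twist :: "complex \<Rightarrow> complex \<Rightarrow> nat \<Rightarrow> complex" where
  "twist T p n = (if even n then p else T * p)"

lemma dist_twist: "norm T = 1 \<Longrightarrow> dist (twist T p n) (twist T q n) = dist p q"
  by (simp add: twist_def dist_norm flip: right_diff_distrib) (simp add: norm_mult)

theorem proposition1p12:
  fixes X :: "complex set" and a :: complex
  assumes "convex X" and "interior X \<noteq> {}"
    and "a \<in> X \<inter> frontier X"
  shows "\<forall>r. normalizing_sequence r \<longrightarrow>
           (\<exists>F. maximal_self_stable X r F \<and> (\<lambda>n. a) \<in> F \<and> \<not> tangent X r F)"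
proof (intro allI impI)
  fix r :: "nat \<Rightarrow> real"
  assume r: "normalizing_sequence r"
  then have pos: "\<forall>n. 0 < r n" by (simp add: normalizing_sequence_def)
  have a: "a \<in> X" "a \<notin> interior X" using assms(3) by (auto simp: frontier_def)
  define D where "D = direction_cone X a"
  obtain T z where T: "norm T = 1" "interior {p \<in> D. T * p \<in> D} \<noteq> {}"
    and z: "z \<in> D" "T * z \<notin> closure D"
    using exists_rotation_not_preserving_cone[OF assms(1,2) a] unfolding D_def by blast
  define P where "P = {p \<in> D. T * p \<in> D}"
  have "0 \<in> D" using hull_subset[of _ cone] a(1) unfolding D_def by force
  then have zero: "0 \<in> P" by (simp add: P_def)
  have span: "span P = UNIV"
    using T(2) unfolding P_def by (rule span_UNIV_if_interior_nonempty)
  define s where "s p = scaled_points X a r (twist T p)" for p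
  have s_rescaled: "\<forall>\<^sub>F n in sequentially. rescaled r a (s p) n = twist T p n" if "p \<in> P" for p
    unfolding s_def
    by (rule rescaled_scaled_points[OF assms(1) a(1) r, of "{p, T * p}"])
      (use that in \<open>auto simp: P_def D_def twist_def\<close>)
  have s_zero: "s 0 = (\<lambda>n. a)" by (simp add: s_def scaled_points_def twist_def fun_eq_iff)

  have "self_stable r (s ` P)"
    unfolding self_stable_def
  proof clarify
    fix p q assume "p \<in> P" "q \<in> P"
    from s_rescaled[OF this(1)] s_rescaled[OF this(2)]
    have "\<forall>\<^sub>F n in sequentially. dist (s p n) (s q n) / r n = dist p q"
    proof eventually_elim
      case (elim n)
      then show ?case
        using dist_rescaled[of r n a "s p" "s q"] pos dist_twist[OF T(1)] by simp
    qed
    then show "mutually_stable r (s p) (s q)"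
      unfolding mutually_stable_def by (intro convergentI[OF tendsto_eventually])
  qed
  moreover have "s ` P \<subseteq> point_sequences X"
    using scaled_points_in[OF a(1)] by (auto simp: s_def)
  ultimately obtain F where F: "maximal_self_stable X r F" "s ` P \<subseteq> F"
    using maximal_self_stable_extension by blast
  then have F_sub: "F \<subseteq> point_sequences X" and F_stable: "self_stable r F"
    by (auto simp: maximal_self_stable_def)

  define \<nu> :: "nat \<Rightarrow> nat" where "\<nu> n = 2 * n" for n
  have \<nu>: "strict_mono \<nu>" by (simp add: \<nu>_def strict_mono_def)
  have F_limits: "\<exists>l. rescaled (r \<circ> \<nu>) a (x \<circ> \<nu>) \<longlonglongrightarrow> l \<and> T * l \<in> closure D"
    if x: "x \<in> F" for x
  proof -
    \<comment> \<open>Undoing the rotation at the odd indices turns the alternating reference sequences into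
      constant ones, from which the position can be found by trilateration.\<close>
    define v where "v n = rescaled r a x n * (if even n then 1 else inverse T)" for n
    have T0: "T \<noteq> 0" using T(1) by auto
    have untwist: "dist (v n) p = dist (rescaled r a x n) (twist T p n)" for n p
    proof (cases "even n")
      case False
      have "v n - p = (rescaled r a x n - T * p) * inverse T"
        using False T0 by (simp add: v_def field_simps)
      then show ?thesis using False T(1) by (simp add: dist_norm twist_def norm_mult norm_inverse)
    qed (simp add: v_def twist_def)
    have "convergent (\<lambda>n. dist (v n) p)" if p: "p \<in> P" for p
    proof -
      have "mutually_stable r x (s p)"
        using F_stable x F(2) p by (auto simp: self_stable_def)
      moreover have "\<forall>\<^sub>F n in sequentially. dist (x n) (s p n) / r n = dist (v n) p"
        using s_rescaled[OF p]
        by eventually_elim (simp add: untwist pos flip: dist_rescaled[of r _ a])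
      ultimately show ?thesis
        unfolding mutually_stable_def by (simp add: convergent_cong)
    qed
    then obtain l where l: "v \<longlonglongrightarrow> l"
      using convergent_if_distances_to_spanning_set_convergent[OF span zero]
      unfolding convergent_def by blast
    have "(v \<circ> \<nu>) \<longlonglongrightarrow> l"
      by (rule LIMSEQ_subseq_LIMSEQ[OF l \<nu>])
    moreover have "rescaled (r \<circ> \<nu>) a (x \<circ> \<nu>) = v \<circ> \<nu>"
      by (simp add: fun_eq_iff v_def rescaled_def \<nu>_def)
    moreover have "T * l \<in> closure D"
    proof -
      have "(\<lambda>n. T * (v \<circ> (\<lambda>n. 2 * n + 1)) n) \<longlonglongrightarrow> T * l"
        by (intro tendsto_mult_left LIMSEQ_subseq_LIMSEQ[OF l]) (simp add: strict_mono_def)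
      moreover have "T * (v \<circ> (\<lambda>n. 2 * n + 1)) n \<in> D" for n
      proof -
        have "rescaled r a x (2 * n + 1) \<in> D"
          unfolding D_def using x F_sub pos
          by (intro rescaled_in_direction_cone) (auto simp: point_sequences_def)
        then show ?thesis using T0 by (simp add: v_def field_simps)
      qed
      ultimately show ?thesis
        unfolding closure_sequential
        by (intro exI[of _ "\<lambda>n. T * (v \<circ> (\<lambda>n. 2 * n + 1)) n"] conjI allI)
    qed
    ultimately show ?thesis by auto
  qed

  have r': "normalizing_sequence (r \<circ> \<nu>)"
    using r LIMSEQ_subseq_LIMSEQ[OF _ \<nu>] by (auto simp: normalizing_sequence_def)
  then have pos': "\<forall>n. 0 < (r \<circ> \<nu>) n" by (simp add: normalizing_sequence_def)
  define y where "y = scaled_points X a (r \<circ> \<nu>) (\<lambda>_. z)"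
  have y_lim: "rescaled (r \<circ> \<nu>) a y \<longlonglongrightarrow> z"
    unfolding y_def
    by (intro tendsto_eventually rescaled_scaled_points[OF assms(1) a(1) r', of "{z}"])
      (use z(1) in \<open>auto simp: D_def\<close>)
  let ?G = "insert y ((\<lambda>x. x \<circ> \<nu>) ` F)"
  have "\<exists>l. rescaled (r \<circ> \<nu>) a x \<longlonglongrightarrow> l" if "x \<in> ?G" for x
    using that y_lim F_limits by blast
  then have "self_stable (r \<circ> \<nu>) ?G"
    unfolding self_stable_def using seq_dist_rescaled_limits(1)[OF pos'] by metis
  moreover have "?G \<subseteq> point_sequences X"
    using F_sub scaled_points_in[OF a(1)] by (auto simp: y_def point_sequences_def)
  ultimately obtain F' where F': "maximal_self_stable X (r \<circ> \<nu>) F'" "?G \<subseteq> F'"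
    using maximal_self_stable_extension by blast
  have "\<not> tangent X r F"
  proof
    assume "tangent X r F"
    with \<nu> F' have iso: "isometry_onto (pretangent_space r F) (pretangent_dist r)
        (pretangent_space (r \<circ> \<nu>) F') (pretangent_dist (r \<circ> \<nu>)) (subseq_embedding r \<nu> F')"
      by (auto simp: tangent_def)
    have "self_stable (r \<circ> \<nu>) F'" using F'(1) by (simp add: maximal_self_stable_def)
    then obtain x where x: "x \<in> F" "seq_dist (r \<circ> \<nu>) (x \<circ> \<nu>) y = 0"
      using iso isometry_onto_iff[OF pos \<nu> F_stable] F'(2) by blast
    obtain l where l: "rescaled (r \<circ> \<nu>) a (x \<circ> \<nu>) \<longlonglongrightarrow> l" "T * l \<in> closure D"
      using F_limits[OF x(1)] by blast
    have "l = z" using seq_dist_rescaled_limits(2)[OF pos' l(1) y_lim] x(2) by simp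
    with l(2) z(2) show False by simp
  qed
  moreover have "(\<lambda>n. a) \<in> F" using F(2) zero s_zero by force
  ultimately show "\<exists>F. maximal_self_stable X r F \<and> (\<lambda>n. a) \<in> F \<and> \<not> tangent X r F"
    using F(1) by blast
qed

end
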